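(* Let $q$ be a prime power, $n\ge 1$ an integer, and $H(x)\in\mathbb{F}_{q^n}[x]$ such that the map $x\mapsto\mathrm{Tr}(H(x))$ is not constant on $\mathbb{F}_{q^n}$. Let $P_H=\{\gamma\in\mathbb{F}_{q^n} : x+\gamma\,\mathrm{Tr}(H(x)) \text{ is a permutation polynomial over } \mathbb{F}_{q^n}\}$. Let $\alpha\in\mathbb{F}_{q^n}$ be nonzero. Then $\alpha\mathbb{F}_q\subset P_H$ if and only if $\alpha$ is a $0$-linear translator of the function $\mathrm{Tr}(H(x))$.
   Context: $\mathrm{Tr}:\mathbb{F}_{q^n}\to\mathbb{F}_q$ is the trace map $\mathrm{Tr}(x)=x+x^q+\cdots+x^{q^{n-1}}$. A polynomial $f$ over $\mathbb{F}_{q^n}$ is a permutation polynomial if the map $x\mapsto f(x)$ is a bijection of $\mathbb{F}_{q^n}$ onto itself. For a function $f:\mathbb{F}_{q^n}\to\mathbb{F}_q$, $a\in\mathbb{F}_q$ and a nonzero $\alpha\in\mathbb{F}_{q^n}$, $\alpha$ is called an $a$-linear translator of $f$ if $f(x+u\alpha)-f(x)=ua$ for all $x\in\mathbb{F}_{q^n}$ and all $u\in\mathbb{F}_q$. Here $\alpha\mathbb{F}_q=\{\alpha u:u\in\mathbb{F}_q\}$, and $\subset$ denotes (not necessarily strict) inclusion. *)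

theory Defs
  imports
    "HOL-Library.Cardinality"
    "HOL-Computational_Algebra.Polynomial"
    "HOL-Number_Theory.Prime_Powers"
begin

text \<open>
  The field with \<open>q ^ n\<close> elements is a type of class \<open>finite_field\<close> with \<open>CARD('a) = q ^ n\<close>;
  its subfield with \<open>q\<close> elements is a set \<open>K\<close> of elements of that type.
\<close>

definition is_subfield :: "'a::field set \<Rightarrow> bool" where
  "is_subfield K \<longleftrightarrow> 0 \<in> K \<and> 1 \<in> K \<and>
     (\<forall>x\<in>K. \<forall>y\<in>K. x + y \<in> K \<and> x * y \<in> K) \<and>
     (\<forall>x\<in>K. - x \<in> K \<and> inverse x \<in> K)"

text \<open>
  The expression \<open>x + x ^ q + \<dots> + x ^ (q ^ (n - 1))\<close> makes sense in every commutative ring. It is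
  used both for field elements (the trace map) and for polynomials over the field, so that
  \<open>trace_expr q n H\<close> is the polynomial \<open>Tr (H(x))\<close>; see \<open>poly_trace_expr\<close>.
\<close>

definition trace_expr :: "nat \<Rightarrow> nat \<Rightarrow> 'a::comm_ring_1 \<Rightarrow> 'a" where
  "trace_expr q n x = (\<Sum>i<n. x ^ (q ^ i))"

lemma poly_trace_expr: "poly (trace_expr q n H) x = trace_expr q n (poly H x)"
  by (simp add: trace_expr_def poly_sum)

definition permutation_polynomial :: "'a::field poly \<Rightarrow> bool" where
  "permutation_polynomial f \<longleftrightarrow> bij (poly f)"

definition P_set :: "nat \<Rightarrow> nat \<Rightarrow> 'a::field poly \<Rightarrow> 'a set" where
  "P_set q n H = {\<gamma>. permutation_polynomial ([:0, 1:] + smult \<gamma> (trace_expr q n H))}"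

text \<open>
  A function into the subfield \<open>K\<close> is encoded as a function into the whole field with values
  in \<open>K\<close>.
\<close>

definition linear_translator :: "'a::field set \<Rightarrow> 'a \<Rightarrow> ('a \<Rightarrow> 'a) \<Rightarrow> 'a \<Rightarrow> bool" where
  "linear_translator K a f \<alpha> \<longleftrightarrow>
     range f \<subseteq> K \<and> a \<in> K \<and> \<alpha> \<noteq> 0 \<and>
     (\<forall>x. \<forall>u\<in>K. f (x + u * \<alpha>) - f x = u * a)"

end

theory Submission
  imports Defs
begin

text \<open>
  Write \<open>f\<close> for \<open>Tr (H(x))\<close>, which takes values in \<open>K\<close>. If \<open>f\<close> is invariant under translation by
  \<open>\<alpha> K\<close> and \<open>x + \<alpha> u f(x) = y + \<alpha> u f(y)\<close>, then \<open>y\<close> and \<open>x\<close> differ by an element of \<open>\<alpha> K\<close>, so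
  \<open>f(x) = f(y)\<close> and hence \<open>x = y\<close>. Conversely, if \<open>f(x + c \<alpha>) \<noteq> f(x)\<close> for some \<open>c \<in> K\<close>, then for
  \<open>u = c / (f(x) - f(x + c \<alpha>))\<close> the points \<open>x\<close> and \<open>x + c \<alpha>\<close> have the same image under
  \<open>x + \<alpha> u f(x)\<close>.
\<close>

lemma is_subfieldD:
  assumes "is_subfield K"
  shows "0 \<in> K" "1 \<in> K"
    and "x \<in> K \<Longrightarrow> y \<in> K \<Longrightarrow> x + y \<in> K"
    and "x \<in> K \<Longrightarrow> y \<in> K \<Longrightarrow> x * y \<in> K"
    and "x \<in> K \<Longrightarrow> - x \<in> K"
    and "x \<in> K \<Longrightarrow> inverse x \<in> K"
  using assms unfolding is_subfield_def by blast+

lemma is_subfield_diff: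
  "is_subfield K \<Longrightarrow> x \<in> K \<Longrightarrow> y \<in> K \<Longrightarrow> x - y \<in> K"
  using is_subfieldD(3,5) by (metis diff_conv_add_uminus)

lemma is_subfield_divide:
  "is_subfield K \<Longrightarrow> x \<in> K \<Longrightarrow> y \<in> K \<Longrightarrow> x / y \<in> K"
  using is_subfieldD(4,6) by (metis divide_inverse)

text \<open>For x \<noteq> 0, multiplication by x permutes the nonzero elements of \<open>K\<close>.
  Comparing the product of these elements before and after gives x ^ (card \<open>K\<close> - 1) =
  1.\<close>

lemma subfield_power_card_eq_same:
  fixes K :: "'a::finite_field set"
  assumes K: "is_subfield K" and x: "x \<in> K"
  shows "x ^ card K = x"
proof (cases "x = 0")
  case True
  have "card K > 0"
    using is_subfieldD(1)[OF K] by (simp add: card_gt_0_iff) blast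
  with True show ?thesis by simp
next
  case False
  let ?U = "K - {0}"
  have bij: "bij_betw ((*) x) ?U ?U"
    by (rule bij_betw_byWitness[where f' = "\<lambda>y. y / x"])
      (use False x in \<open>auto intro: is_subfieldD(4)[OF K] is_subfield_divide[OF K]\<close>)
  have "(\<Prod>y\<in>?U. x * y) = \<Prod>?U"
    by (rule prod.reindex_bij_betw[OF bij, where g = "\<lambda>y. y"])
  then have "x ^ card ?U * \<Prod>?U = \<Prod>?U"
    by (simp add: prod.distrib)
  moreover have "\<Prod>?U \<noteq> 0"
    by (simp add: prod_zero_iff)
  ultimately have "x ^ card ?U = 1"
    by simp
  moreover have "card K = Suc (card ?U)"
    by (rule card.remove) (simp_all add: is_subfieldD(1)[OF K])
  ultimately show ?thesis
    by (simp only: power_Suc mult_1_right)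
qed

text \<open>The elements of \<open>K\<close> are already card \<open>K\<close> roots of X ^ card
  \<open>K\<close> - X, which has no room for more. This turns membership in \<open>K\<close> into
  an equation that can be checked on the trace.\<close>

lemma subfield_eq_fixed_points:
  fixes K :: "'a::finite_field set"
  assumes K: "is_subfield K"
  shows "K = {x. x ^ card K = x}"
proof (rule card_seteq)
  \<comment> \<open>The bound card \<open>K\<close> \<ge> 2 keeps the two monomials of
    \<open>?p\<close> from cancelling, so that \<open>?p\<close> is nonzero and its roots can be
    counted.\<close>
  have "{0, 1} \<subseteq> K"
    using is_subfieldD(1,2)[OF K] by blast
  then have q: "card K \<ge> 2"
    using card_mono[of K "{0, 1}"] by simp
  let ?p = "monom 1 (card K) - monom 1 1 :: 'a poly"
  have deg: "degree ?p \<le> card K"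
    using q by (intro degree_diff_le) (auto simp: degree_monom_eq)
  have "coeff ?p (card K) \<noteq> 0"
    using q by simp
  then have "?p \<noteq> 0"
    by (metis coeff_0)
  then have "card {x. poly ?p x = 0} \<le> card K"
    using card_poly_roots_bound deg order_trans by blast
  then show "card {x :: 'a. x ^ card K = x} \<le> card K"
    by (simp add: poly_monom)
qed (use subfield_power_card_eq_same[OF K] in auto)

text \<open>This makes x \<mapsto> x ^ q an iterate of the Frobenius map, hence additive. The prime
  below q must be the characteristic, because the characteristic divides the order of the
  field.\<close>

lemma primepow_CARD_finite_fieldD:
  assumes "primepow q" and "CARD('a::finite_field) = q ^ n"
  obtains k where "q = CHAR('a) ^ k"
proof -
  obtain p k where pk: "prime p" "q = p ^ k"
    using assms(1) by (auto simp: primepow_def)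
  have "prime CHAR('a)"
    by (rule prime_CHAR_semidom) simp
  moreover have "CHAR('a) dvd p ^ (k * n)"
  proof -
    \<comment> \<open>Translation by 1 permutes the field, so it preserves the sum of all elements;
      it also adds \<open>CARD('a)\<close> times 1 to that sum, which is therefore 0.\<close>
    have "bij_betw (\<lambda>x. x + 1) (UNIV :: 'a set) UNIV"
      by (rule bij_betw_byWitness[where f' = "\<lambda>x. x - 1"]) auto
    then have "(\<Sum>x\<in>UNIV. x + 1) = (\<Sum>x\<in>UNIV. x :: 'a)"
      by (rule sum.reindex_bij_betw[where g = "\<lambda>x. x"])
    then have "of_nat CARD('a) = (0 :: 'a)"
      by (simp add: sum.distrib)
    then show ?thesis
      using assms(2) pk(2) by (simp only: of_nat_eq_0_iff_char_dvd power_mult)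
  qed
  ultimately have "CHAR('a) = p"
    using pk(1) by (metis prime_dvd_power primes_dvd_imp_eq)
  with pk(2) that show ?thesis by blast
qed

text \<open>Raising to the power q shifts the summands of the trace cyclically, so the trace is a
  fixed point of x \<mapsto> x ^ q and lies in \<open>K\<close>.\<close>

lemma trace_expr_in_subfield:
  fixes x :: "'a::finite_field"
  assumes q: "primepow q" and card: "CARD('a) = q ^ n"
    and K: "is_subfield K" and cardK: "card K = q"
  shows "trace_expr q n x \<in> K"
proof -
  obtain k where k: "q = CHAR('a) ^ k"
    using primepow_CARD_finite_fieldD[OF q card] .
  have "trace_expr q n x ^ q = (\<Sum>i<n. (x ^ q ^ i) ^ q)"
    unfolding trace_expr_def by (rule freshmans_dream_sum'[OF _ k]) (rule prime_CHAR_semidom, simp)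
  also have "\<dots> = (\<Sum>i<n. x ^ q ^ Suc i)"
    by (simp flip: power_mult add: mult.commute)
  also have "\<dots> = trace_expr q n x"
  proof -
    \<comment> \<open>The summand with exponent q ^ n that the shift produces is the lost summand x.
      Splitting the sum over i < Suc n at its last and at its first term then identifies the two
      sums.\<close>
    have "x ^ q ^ n = x"
      using finite_field_power_card_eq_same[of x] card by simp
    then show ?thesis
      using sum.lessThan_Suc[of "\<lambda>i. x ^ q ^ i" n] sum.lessThan_Suc_shift[of "\<lambda>i. x ^ q ^ i" n]
      by (simp add: trace_expr_def)
  qed
  finally show ?thesis
    using subfield_eq_fixed_points[OF K] cardK by blast
qed

lemma inj_add_mult_iff_translation_invariant:
  fixes f :: "'a::field \<Rightarrow> 'a"
  assumes K: "is_subfield K" and f: "\<And>x. f x \<in> K" and \<alpha>: "\<alpha> \<noteq> 0"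
  shows "(\<forall>u\<in>K. inj (\<lambda>x. x + \<alpha> * u * f x)) \<longleftrightarrow> (\<forall>x. \<forall>c\<in>K. f (x + c * \<alpha>) = f x)"
proof (intro iffI allI ballI)
  fix x c
  assume inj: "\<forall>u\<in>K. inj (\<lambda>x. x + \<alpha> * u * f x)" and c: "c \<in> K"
  show "f (x + c * \<alpha>) = f x"
  proof (rule ccontr)
    assume neq: "f (x + c * \<alpha>) \<noteq> f x"
    define d where "d = f (x + c * \<alpha>)"
    define u where "u = c / (f x - d)"
    have u: "u \<in> K"
      unfolding u_def d_def by (intro is_subfield_divide is_subfield_diff K c f)
    have "c = u * (f x - d)"
      using neq by (simp add: u_def d_def)
    then have "c * \<alpha> = u * (f x - d) * \<alpha>"
      by (rule arg_cong)
    then have "x + \<alpha> * u * f x = x + c * \<alpha> + \<alpha> * u * d"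
      by (simp add: algebra_simps)
    \<comment> \<open>Once the two points coincide, so do their values under f, against
      \<open>neq\<close>; the case c = 0 is thus covered too.\<close>
    then have "x = x + c * \<alpha>"
      unfolding d_def by (rule injD[OF inj[rule_format, OF u]])
    with neq show False by simp
  qed
next
  fix u
  assume inv: "\<forall>x. \<forall>c\<in>K. f (x + c * \<alpha>) = f x" and u: "u \<in> K"
  show "inj (\<lambda>x. x + \<alpha> * u * f x)"
  proof (rule injI)
    fix x y
    assume eq: "x + \<alpha> * u * f x = y + \<alpha> * u * f y"
    have "y = x + \<alpha> * u * f x - \<alpha> * u * f y"
      by (simp add: eq)
    also have "\<dots> = x + u * (f x - f y) * \<alpha>"
      by (simp add: algebra_simps)
    finally have "f y = f (x + u * (f x - f y) * \<alpha>)"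
      by (rule arg_cong)
    also have "\<dots> = f x"
      by (intro inv[rule_format] is_subfieldD(4)[OF K] is_subfield_diff K u f)
    finally have "f y = f x" .
    with eq show "x = y" by simp
  qed
qed

theorem theorem2p4:
  fixes q n :: nat
    and K :: "'a::finite_field set"
    and H :: "'a poly"
    and \<alpha> :: 'a
  assumes "primepow q"
    and "n \<ge> 1"
    and "CARD('a) = q ^ n"
    and "is_subfield K" and "card K = q"
    and "\<not> (\<exists>c. \<forall>x. trace_expr q n (poly H x) = c)"
    and "\<alpha> \<noteq> 0"
  shows "{\<alpha> * u | u. u \<in> K} \<subseteq> P_set q n H \<longleftrightarrow>
         linear_translator K 0 (\<lambda>x. trace_expr q n (poly H x)) \<alpha>"
proof -
  let ?f = "\<lambda>x. trace_expr q n (poly H x)"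
  have f: "?f x \<in> K" for x
    using assms by (intro trace_expr_in_subfield)
  have bij_iff_inj: "bij g \<longleftrightarrow> inj g" for g :: "'a \<Rightarrow> 'a"
    by (metis bij_def finite finite_UNIV_inj_surj)
  have "poly ([:0, 1:] + smult \<gamma> (trace_expr q n H)) = (\<lambda>x. x + \<gamma> * ?f x)" for \<gamma>
    by (simp add: fun_eq_iff poly_trace_expr)
  then have "P_set q n H = {\<gamma>. inj (\<lambda>x. x + \<gamma> * ?f x)}"
    unfolding P_set_def permutation_polynomial_def bij_iff_inj by (simp only:)
  then have "{\<alpha> * u | u. u \<in> K} \<subseteq> P_set q n H \<longleftrightarrow> (\<forall>u\<in>K. inj (\<lambda>x. x + \<alpha> * u * ?f x))"
    by blast
  also have "\<dots> \<longleftrightarrow> (\<forall>x. \<forall>c\<in>K. ?f (x + c * \<alpha>) = ?f x)"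
    by (rule inj_add_mult_iff_translation_invariant[OF assms(4) f assms(7)])
  \<comment> \<open>For a = 0 the translator equation says that the difference vanishes, which is
    the invariance; the side conditions follow from \<open>f\<close>, 0 \<in> K and \<alpha>
    \<noteq> 0.\<close>
  also have "\<dots> \<longleftrightarrow> linear_translator K 0 ?f \<alpha>"
    using f is_subfieldD(1)[OF assms(4)] assms(7) by (simp add: linear_translator_def image_subset_iff)
  finally show ?thesis .
qed

end
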